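(* Let $m$ be a positive integer with $m\equiv 0\pmod 4$, let $e=3^{\frac{m}{2}}+1$, and let $s=\frac{3^m-1}{2}$. Then $\mathcal{C}_{(1,e,s)}$ is an optimal ternary cyclic code with parameters $[3^m-1,\ 3^m-\frac{3m}{2}-2,\ 4]$.
   Context: Let $m$ be a positive integer, $\mathbb{F}_{3^m}$ the finite field with $3^m$ elements, and $\alpha$ a generator of the multiplicative group $\mathbb{F}_{3^m}^*$. For an integer $i$, $m_{\alpha^i}(x)$ denotes the minimal polynomial of $\alpha^i$ over $\mathbb{F}_3$. An $[n,k,d]$ linear code over $\mathbb{F}_3$ is a $k$-dimensional subspace of $\mathbb{F}_3^n$ with minimum Hamming distance $d$. A ternary cyclic code of length $n$ (with $\gcd(n,3)=1$) is identified with an ideal of $\mathbb{F}_3[x]/(x^n-1)$ via $(c_0,\dots,c_{n-1})\mapsto c_0+c_1x+\cdots+c_{n-1}x^{n-1}$; its generator polynomial is the monic polynomial of least degree generating the ideal. $\mathcal{C}_{(i_1,i_2,\dots,i_t)}$ denotes the ternary cyclic code of length $3^m-1$ with generator polynomial $m_{\alpha^{i_1}}(x)m_{\alpha^{i_2}}(x)\cdots m_{\alpha^{i_t}}(x)$. A ternary $[n,k,d]$ code is optimal (in the standard sense) if no linear code over $\mathbb{F}_3$ of length $n$ and dimension $k$ has minimum distance larger than $d$. *)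

theory Defs
  imports "Jordan_Normal_Form.VS_Connect" "HOL-Algebra.QuotRing"
    "HOL-Library.Cardinality"
begin

definition hamming_dist :: "'a vec \<Rightarrow> 'a vec \<Rightarrow> nat" where
  "hamming_dist u v = card {i. i < dim_vec u \<and> u $ i \<noteq> v $ i}"

text \<open>The infimum over the empty set of naturals is 0, so the zero code gets minimum distance 0.\<close>

definition min_distance :: "'a vec set \<Rightarrow> nat" where
  "min_distance C = Inf {hamming_dist u v | u v. u \<in> C \<and> v \<in> C \<and> u \<noteq> v}"

definition linear_code :: "nat \<Rightarrow> nat \<Rightarrow> nat \<Rightarrow> 'f::field vec set \<Rightarrow> bool" where
  "linear_code n k d C \<longleftrightarrow>
     VectorSpace.subspace class_ring C (module_vec TYPE('f) n) \<and>
     vectorspace.dim class_ring ((module_vec TYPE('f) n)\<lparr>carrier := C\<rparr>) = k \<and>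
     min_distance C = d"

definition optimal_code :: "nat \<Rightarrow> nat \<Rightarrow> nat \<Rightarrow> 'f::field vec set \<Rightarrow> bool" where
  "optimal_code n k d C \<longleftrightarrow>
     linear_code n k d C \<and> \<not> (\<exists>(C' :: 'f vec set) d'. linear_code n k d' C' \<and> d < d')"

text \<open>Words of length \<open>n\<close> are identified with the elements of \<open>F[x]/(x^n - 1)\<close> via
  \<open>(c_0, ..., c_{n-1}) \<mapsto> c_0 + c_1 x + ... + c_{n-1} x^{n-1}\<close>.  The polynomial ring is
  the type \<open>'f poly\<close> viewed as a ring record.\<close>

definition cyclic_modulus :: "nat \<Rightarrow> 'f::field poly set" where
  "cyclic_modulus n = cgenideal class_ring (monom 1 n - 1)"

definition cyclic_ring :: "nat \<Rightarrow> 'f::field poly set ring" where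
  "cyclic_ring n = FactRing class_ring (cyclic_modulus n)"

definition residue_class :: "nat \<Rightarrow> 'f::field poly \<Rightarrow> 'f poly set" where
  "residue_class n p = a_r_coset class_ring (cyclic_modulus n) p"

definition word_class :: "nat \<Rightarrow> 'f::field vec \<Rightarrow> 'f poly set" where
  "word_class n c = residue_class n (Poly (list_of_vec c))"

definition cyclic_code :: "nat \<Rightarrow> 'f::field vec set \<Rightarrow> bool" where
  "cyclic_code n C \<longleftrightarrow> C \<subseteq> carrier_vec n \<and> ideal (word_class n ` C) (cyclic_ring n)"

definition generates_code :: "nat \<Rightarrow> 'f::field vec set \<Rightarrow> 'f poly \<Rightarrow> bool" where
  "generates_code n C g \<longleftrightarrow> word_class n ` C = cgenideal (cyclic_ring n) (residue_class n g)"

definition generator_poly :: "nat \<Rightarrow> 'f::field vec set \<Rightarrow> 'f poly \<Rightarrow> bool" where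
  "generator_poly n C g \<longleftrightarrow>
     lead_coeff g = 1 \<and> generates_code n C g \<and>
     (\<forall>h. lead_coeff h = 1 \<and> generates_code n C h \<longrightarrow> degree g \<le> degree h)"

definition code_generated_by :: "nat \<Rightarrow> 'f::field poly \<Rightarrow> 'f vec set" where
  "code_generated_by n g =
     {c \<in> carrier_vec n. word_class n c \<in> cgenideal (cyclic_ring n) (residue_class n g)}"

text \<open>\<open>\<iota>\<close> is the embedding of the base field \<open>'f\<close> into the extension field \<open>'a\<close>.\<close>

definition min_poly :: "('f::field \<Rightarrow> 'a::field) \<Rightarrow> 'a \<Rightarrow> 'f poly" where
  "min_poly \<iota> \<beta> = (THE p. lead_coeff p = 1 \<and> poly (map_poly \<iota> p) \<beta> = 0 \<and>
     (\<forall>q. q \<noteq> 0 \<and> poly (map_poly \<iota> q) \<beta> = 0 \<longrightarrow> degree p \<le> degree q))"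

definition mult_generator :: "'a::field \<Rightarrow> bool" where
  "mult_generator \<alpha> \<longleftrightarrow> range (\<lambda>k::int. \<alpha> powi k) = UNIV - {0}"

definition root_gen_poly :: "('f::field \<Rightarrow> 'a::field) \<Rightarrow> 'a \<Rightarrow> int list \<Rightarrow> 'f poly" where
  "root_gen_poly \<iota> \<alpha> is = (\<Prod>i\<leftarrow>is. min_poly \<iota> (\<alpha> powi i))"

definition root_code :: "('f::field \<Rightarrow> 'a::field) \<Rightarrow> 'a \<Rightarrow> int list \<Rightarrow> 'f vec set" where
  "root_code \<iota> \<alpha> is = code_generated_by (CARD('a) - 1) (root_gen_poly \<iota> \<alpha> is)"

end

(* A word of weight at most 3 is excluded through its values at alpha, alpha^(q+1) and -1, where
   q = 3^(m/2).  Let eta(x) = x^s be the quadratic character.  For weight 3, with positions x_i and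
   coefficients u_i = +-1, the value at -1 = alpha^s gives sum u_i eta(x_i) = 0, so all u_i eta(x_i)
   agree; hence y_i = eta(x_i) x_i satisfy y_1 + y_2 + y_3 = 0 and sum eta(y_i) y_i^(q+1) = 0.  Two of
   the eta(y_i) are equal, which leads to y_i = y_j or to (y_i / y_j)^(q-1) = -1, the latter being
   impossible for a square because (q+1)/2 is odd.  Conversely, a distance above 4 would make the
   (3^m - 1)^2 errors of weight 2 with one position in each half of the word have distinct
   syndromes, whereas there are only 3^(3m/2+1) of these. *)

theory Submission
  imports Defs "Jordan_Normal_Form.Char_Poly"
begin

section \<open>Cyclic codes and their generator polynomials\<close>

definition word_poly :: "'f::zero vec \<Rightarrow> 'f poly" where
  "word_poly c = Poly (list_of_vec c)"

lemma coeff_word_poly: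
  assumes "c \<in> carrier_vec n"
  shows "coeff (word_poly c) i = (if i < n then c $ i else 0)"
  using assms by (simp add: word_poly_def nth_default_def list_of_vec_index)

text \<open>The disjunct \<open>p = 0\<close> matters for \<open>n = 0\<close>: the zero polynomial
  has degree 0, which is not below \<open>n\<close>.\<close>

lemma word_poly_vec_coeff:
  assumes "p = 0 \<or> degree p < n"
  shows "word_poly (vec n (coeff p)) = p"
proof (rule poly_eqI)
  fix i
  have "coeff p i = 0" if "\<not> i < n" using assms that by (auto intro: coeff_eq_0)
  then show "coeff (word_poly (vec n (coeff p))) i = coeff p i"
    by (subst coeff_word_poly[of _ n]) auto
qed

lemma degree_word_poly:
  assumes "c \<in> carrier_vec n"
  shows "word_poly c = 0 \<or> degree (word_poly c) < n"
proof (rule disjCI)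
  assume "\<not> degree (word_poly c) < n"
  then have "lead_coeff (word_poly c) = 0" by (subst coeff_word_poly[OF assms]) simp
  then show "word_poly c = 0" by simp
qed

lemma bij_betw_word_poly:
  "bij_betw word_poly (carrier_vec n) {p. p = 0 \<or> degree p < n}"
proof (rule bij_betw_byWitness[where f' = "\<lambda>p. vec n (coeff p)"])
  show "\<forall>c\<in>carrier_vec n. vec n (coeff (word_poly c)) = c"
    by (auto simp: coeff_word_poly)
qed (use word_poly_vec_coeff degree_word_poly in auto)

lemma card_carrier_vec:
  "card (carrier_vec n :: 'f::finite vec set) = CARD('f) ^ n"
proof -
  have "bij_betw list_of_vec (carrier_vec n) {xs :: 'f list. set xs \<subseteq> UNIV \<and> length xs = n}"
    by (rule bij_betw_byWitness[where f' = vec_of_list]) (auto simp: list_vec vec_list intro: carrier_vecI)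
  from bij_betw_same_card[OF this] show ?thesis
    using card_lists_length_eq[of "UNIV :: 'f set" n] by simp
qed

lemma card_poly_degree_less:
  "card {p :: 'f::{zero,finite} poly. p = 0 \<or> degree p < n} = CARD('f) ^ n"
  using bij_betw_same_card[OF bij_betw_word_poly] card_carrier_vec by metis

text \<open>Multiplication by \<open>g\<close> is a bijection from the polynomials of degree below
  \<open>n - degree g\<close> onto the multiples of \<open>g\<close> of degree below
  \<open>n\<close>. The count later yields the dimension without exhibiting a basis.\<close>

lemma card_words_dvd:
  fixes g :: "'f::{field,finite} poly"
  assumes "g \<noteq> 0" and "degree g \<le> n"
  shows "card {c \<in> carrier_vec n. g dvd word_poly c} = CARD('f) ^ (n - degree g)"
proof -
  let ?P = "\<lambda>k. {p :: 'f poly. p = 0 \<or> degree p < k}"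
  have "word_poly ` {c \<in> carrier_vec n. g dvd word_poly c} = {p \<in> word_poly ` carrier_vec n. g dvd p}"
    by auto
  also have "word_poly ` carrier_vec n = ?P n"
    using bij_betw_word_poly by (rule bij_betw_imp_surj_on)
  finally have "bij_betw word_poly {c \<in> carrier_vec n. g dvd word_poly c} {p \<in> ?P n. g dvd p}"
    by (intro bij_betw_subset[OF bij_betw_word_poly]) auto
  then have "card {c \<in> carrier_vec n. g dvd word_poly c} = card {p \<in> ?P n. g dvd p}"
    by (rule bij_betw_same_card)
  also have "\<dots> = card ((*) g ` ?P (n - degree g))"
  proof (rule arg_cong[where f = card], intro equalityI subsetI)
    fix p assume "p \<in> {p \<in> ?P n. g dvd p}"
    then obtain h where h: "p = g * h" "p = 0 \<or> degree p < n" by (blast elim: dvdE)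
    then have "h = 0 \<or> degree h < n - degree g"
      using assms(1) by (cases "h = 0") (auto simp: degree_mult_eq)
    then show "p \<in> (*) g ` ?P (n - degree g)" using h by auto
  next
    fix p assume "p \<in> (*) g ` ?P (n - degree g)"
    then obtain h where h: "p = g * h" "h = 0 \<or> degree h < n - degree g" by auto
    then show "p \<in> {p \<in> ?P n. g dvd p}"
      using assms by (cases "h = 0") (auto simp: degree_mult_eq)
  qed
  also have "\<dots> = card (?P (n - degree g))"
    using assms(1) by (intro card_image) (auto simp: inj_on_def)
  finally show ?thesis by (simp only: card_poly_degree_less)
qed

section \<open>The quotient ring modulo x^n - 1 and its principal ideals\<close>

lemma cyclic_modulus_eq: "cyclic_modulus n = {p. monom 1 n - 1 dvd p}"
  unfolding cyclic_modulus_def cgenideal_def by (auto simp: dvd_def mult.commute)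

lemma ideal_cyclic_modulus: "ideal (cyclic_modulus n) (class_ring :: 'f::field poly ring)"
proof -
  have "cring (class_ring :: 'f poly ring)" ..
  then show ?thesis unfolding cyclic_modulus_def by (rule cring.cgenideal_ideal) simp
qed

lemma residue_class_eq: "residue_class n p = {q. monom 1 n - 1 dvd q - p}"
proof -
  have "q \<in> residue_class n p \<longleftrightarrow> monom 1 n - 1 dvd q - p" for q
    unfolding residue_class_def a_r_coset_def r_coset_def cyclic_modulus_eq
    by (auto intro: exI[of _ "q - p"])
  then show ?thesis by blast
qed

lemma residue_class_eq_iff:
  "residue_class n p = residue_class n q \<longleftrightarrow> monom 1 n - 1 dvd p - q"
proof
  assume "residue_class n p = residue_class n q"
  moreover have "p \<in> residue_class n p" by (simp add: residue_class_eq)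
  ultimately show "monom 1 n - 1 dvd p - q" by (simp add: residue_class_eq)
next
  assume d: "monom 1 n - 1 dvd p - q"
  have "monom 1 n - 1 dvd r - p \<longleftrightarrow> monom 1 n - 1 dvd r - q" for r
    using dvd_add_left_iff[OF d, of "r - p"] by (simp add: algebra_simps)
  then show "residue_class n p = residue_class n q" by (simp add: residue_class_eq)
qed

lemma carrier_cyclic_ring: "carrier (cyclic_ring n) = range (residue_class n)"
  by (auto simp: cyclic_ring_def FactRing_def A_RCOSETS_def RCOSETS_def a_r_coset_def
      residue_class_def)

lemma residue_class_mult:
  "residue_class n p \<otimes>\<^bsub>cyclic_ring n\<^esub> residue_class n q = residue_class n (p * q)"
  using ideal.rcoset_mult_add[OF ideal_cyclic_modulus, of p q n]
  by (simp add: cyclic_ring_def FactRing_def residue_class_def)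

lemma cgenideal_residue_class:
  "cgenideal (cyclic_ring n) (residue_class n g) = residue_class n ` {p. g dvd p}"
proof -
  have "cgenideal (cyclic_ring n) (residue_class n g) = (\<lambda>h. residue_class n (h * g)) ` UNIV"
    unfolding cgenideal_def carrier_cyclic_ring by (force simp: residue_class_mult[symmetric])
  also have "\<dots> = residue_class n ` {p. g dvd p}"
    by (auto simp: dvd_def mult.commute)
  finally show ?thesis .
qed

lemma cring_cyclic_ring: "cring (cyclic_ring n)"
  unfolding cyclic_ring_def
  by (rule ideal.quotient_is_cring[OF ideal_cyclic_modulus]) unfold_locales

text \<open>Representatives of one class differ by a multiple of x^n - 1, hence of \<open>g\<close>,
  so divisibility by \<open>g\<close> depends on the class only. This turns ideal membership into a
  condition on the word polynomial.\<close>

lemma residue_class_in_cgenideal_iff: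
  assumes "g dvd monom 1 n - 1"
  shows "residue_class n p \<in> cgenideal (cyclic_ring n) (residue_class n g) \<longleftrightarrow> g dvd p"
proof -
  have "g dvd p" if "monom 1 n - 1 dvd p - q" "g dvd q" for q
    using dvd_add[OF dvd_trans[OF assms that(1)] that(2)] by simp
  then show ?thesis
    by (auto simp: cgenideal_residue_class residue_class_eq_iff)
qed

lemma code_generated_by_eq:
  assumes "g dvd monom 1 n - 1"
  shows "code_generated_by n g = {c \<in> carrier_vec n. g dvd word_poly c}"
  unfolding code_generated_by_def word_class_def word_poly_def[symmetric]
  using residue_class_in_cgenideal_iff[OF assms] by blast

text \<open>The word is read off from the remainder modulo x^n - 1. Positivity of \<open>n\<close>
  gives the modulus degree \<open>n\<close>; for \<open>n = 0\<close> it would vanish.\<close>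

lemma residue_class_word:
  fixes p :: "'f::field poly"
  assumes "n > 0"
  shows "\<exists>c \<in> carrier_vec n. word_class n c = residue_class n p"
proof -
  let ?M = "monom 1 n - 1 :: 'f poly" and ?r = "p mod (monom 1 n - 1)"
  have deg: "degree ?M = n"
    using assms degree_add_eq_left[of "- 1 :: 'f poly" "monom 1 n"] by (simp add: degree_monom_eq)
  then have "?M \<noteq> 0" using assms by force
  with degree_mod_less[OF this, of p] deg have "?r = 0 \<or> degree ?r < n" by auto
  then have "word_poly (vec n (coeff ?r)) = ?r" by (rule word_poly_vec_coeff)
  moreover have "?M dvd ?r - p"
    using dvd_minus_mod[of ?M p] by (simp add: dvd_diff_commute)
  ultimately have "word_class n (vec n (coeff ?r)) = residue_class n p"
    by (simp add: word_class_def word_poly_def[symmetric] residue_class_eq_iff del: list_of_vec_vec)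
  then show ?thesis using vec_carrier by blast
qed

lemma generates_code_generated_by:
  assumes "n > 0"
  shows "generates_code n (code_generated_by n g) g"
proof -
  have "x \<in> word_class n ` code_generated_by n g"
    if x: "x \<in> cgenideal (cyclic_ring n) (residue_class n g)" for x
  proof -
    from x obtain p where "x = residue_class n p" by (auto simp: cgenideal_residue_class)
    with residue_class_word[OF assms, of p] x show ?thesis
      by (force simp: code_generated_by_def)
  qed
  then show ?thesis
    by (auto simp: generates_code_def code_generated_by_def)
qed

lemma cyclic_code_generated_by:
  assumes "n > 0"
  shows "cyclic_code n (code_generated_by n g)"
proof -
  interpret R: cring "cyclic_ring n" by (rule cring_cyclic_ring)
  have "ideal (cgenideal (cyclic_ring n) (residue_class n g)) (cyclic_ring n)"
    by (rule R.cgenideal_ideal) (simp add: carrier_cyclic_ring)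
  then show ?thesis
    using generates_code_generated_by[OF assms, of g]
    by (auto simp: cyclic_code_def generates_code_def code_generated_by_def)
qed

text \<open>A competing generator \<open>h\<close> lies in the ideal of \<open>g\<close>; as
  \<open>g\<close> divides x^n - 1, this means that \<open>g\<close> divides
  \<open>h\<close>.\<close>

lemma generator_poly_generated_by:
  assumes "n > 0" and "g dvd monom 1 n - 1" and "lead_coeff g = 1"
  shows "generator_poly n (code_generated_by n g) g"
proof -
  have "degree g \<le> degree h"
    if "lead_coeff h = 1" "generates_code n (code_generated_by n g) h" for h
  proof -
    have "residue_class n h \<in> cgenideal (cyclic_ring n) (residue_class n h)"
      by (simp add: cgenideal_residue_class)
    then have "g dvd h"
      using that(2) generates_code_generated_by[OF assms(1), of g]
      by (simp add: generates_code_def residue_class_in_cgenideal_iff[OF assms(2)])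
    then show ?thesis using that(1) by (intro dvd_imp_degree_le) auto
  qed
  then show ?thesis
    using assms generates_code_generated_by by (auto simp: generator_poly_def)
qed

section \<open>Dimension and packing bounds over a finite field\<close>

text \<open>Coordinates in a finite basis identify vectors with functions from the basis to the
  scalars. Code dimensions are read off from cardinalities through this.\<close>

lemma (in vectorspace) card_carrier:
  assumes "fin_dim" and "finite (carrier K)"
  shows "card (carrier V) = card (carrier K) ^ dim"
proof -
  from finite_basis_exists[OF assms(1)] obtain B where B: "finite B" "basis B" by blast
  then have BV: "B \<subseteq> carrier V" by (simp add: basis_def)
  have "bij_betw (\<lambda>a. lincomb a B) (B \<rightarrow>\<^sub>E carrier K) (carrier V)"
  proof (rule bij_betw_imageI)
    have u: "\<forall>v. v \<in> carrier V \<longrightarrow> (\<exists>!a. a \<in> B \<rightarrow>\<^sub>E carrier K \<and> lincomb a B = v)"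
      using basis_criterion[OF B(1) BV] B(2) by blast
    have closed: "lincomb a B \<in> carrier V" if "a \<in> B \<rightarrow>\<^sub>E carrier K" for a
      using that BV by (intro lincomb_closed) auto
    show "inj_on (\<lambda>a. lincomb a B) (B \<rightarrow>\<^sub>E carrier K)"
      using u closed unfolding inj_on_def by blast
    show "(\<lambda>a. lincomb a B) ` (B \<rightarrow>\<^sub>E carrier K) = carrier V"
      using u closed by blast
  qed
  from bij_betw_same_card[OF this] show ?thesis
    using dim_basis[OF B] card_PiE[OF B(1), of "\<lambda>_. carrier K"] by simp
qed

lemma card_subspace:
  fixes C :: "'f::{field,finite} vec set"
  assumes "VectorSpace.subspace class_ring C (module_vec TYPE('f) n)"
  shows "card C = CARD('f) ^ vectorspace.dim class_ring ((module_vec TYPE('f) n)\<lparr>carrier := C\<rparr>)"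
proof -
  interpret vec_space "TYPE('f)" n .
  interpret W: vectorspace class_ring "V\<lparr>carrier := C\<rparr>"
    using subspace_is_vs[OF assms] .
  have "C \<subseteq> carrier_vec n"
    using assms by (auto simp: VectorSpace.subspace_def submodule_def)
  moreover have "finite (carrier_vec n :: 'f vec set)"
    using card_carrier_vec[where 'f = 'f, of n] by (intro card_ge_0_finite) simp
  ultimately have "finite C" by (rule finite_subset)
  \<comment> \<open>A finite code is a finite spanning set of itself, which is what
    \<open>fin_dim\<close> asks for.\<close>
  moreover have "W.span C = C"
    using W.span_is_subset2[of C] W.in_own_span[of C] by auto
  ultimately have "W.fin_dim" unfolding W.fin_dim_def by auto
  from W.card_carrier[OF this] show ?thesis by simp
qed

section \<open>Codes defined by divisibility as linear codes\<close>

lemma subspace_words: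
  fixes C :: "'f::field vec set"
  assumes "C \<subseteq> carrier_vec n" and "0\<^sub>v n \<in> C"
    and "\<And>u v. u \<in> C \<Longrightarrow> v \<in> C \<Longrightarrow> u + v \<in> C" and "\<And>a u. u \<in> C \<Longrightarrow> a \<cdot>\<^sub>v u \<in> C"
  shows "VectorSpace.subspace class_ring C (module_vec TYPE('f) n)"
  unfolding VectorSpace.subspace_def submodule_def
  using assms vec_vs vec_module by (auto simp: module_vec_simps)

lemma word_poly_add:
  assumes "u \<in> carrier_vec n" and "v \<in> carrier_vec n"
  shows "word_poly (u + v) = word_poly u + word_poly v"
  using assms by (intro poly_eqI) (simp add: coeff_word_poly[of _ n])

lemma word_poly_smult:
  fixes a :: "'f::field"
  assumes "u \<in> carrier_vec n"
  shows "word_poly (a \<cdot>\<^sub>v u) = Polynomial.smult a (word_poly u)"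
  using assms by (intro poly_eqI) (simp add: coeff_word_poly[of _ n])

lemma subspace_words_dvd:
  "VectorSpace.subspace class_ring {c \<in> carrier_vec n. g dvd word_poly c} (module_vec TYPE('f::field) n)"
proof (rule subspace_words)
  have "word_poly (0\<^sub>v n :: 'f vec) = 0"
    by (rule poly_eqI) (simp add: coeff_word_poly[of _ n])
  then show "0\<^sub>v n \<in> {c \<in> carrier_vec n. g dvd word_poly c}" by simp
qed (auto simp: word_poly_add[of _ n] word_poly_smult[of _ n] dvd_smult)

lemma linear_code_words_dvd:
  fixes g :: "'f::{field,finite} poly"
  assumes "g \<noteq> 0" and "degree g \<le> n"
  defines "C \<equiv> {c \<in> carrier_vec n. g dvd word_poly c}"
  shows "linear_code n (n - degree g) (min_distance C) C"
proof -
  have sub: "VectorSpace.subspace class_ring C (module_vec TYPE('f) n)"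
    unfolding C_def by (rule subspace_words_dvd)
  \<comment> \<open>The base must exceed 1 before equal powers give equal exponents.\<close>
  have "card {0 :: 'f, 1} \<le> CARD('f)" by (rule card_mono) auto
  then have "1 < CARD('f)" by simp
  then have "vectorspace.dim class_ring ((module_vec TYPE('f) n)\<lparr>carrier := C\<rparr>) = n - degree g"
    using card_subspace[OF sub] card_words_dvd[OF assms(1,2)] by (simp add: C_def)
  then show ?thesis using sub by (simp add: linear_code_def)
qed

lemma min_distance_le:
  assumes "u \<in> C" and "v \<in> C" and "u \<noteq> v"
  shows "min_distance C \<le> hamming_dist u v"
  unfolding min_distance_def using assms by (intro cInf_lower) auto

text \<open>A sphere packing bound that counts, around each codeword, only the errors consisting of one
  nonzero entry among the first \<open>h\<close> positions and one among the next \<open>h\<close>.\<close>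

lemma double_error_packing:
  fixes C :: "'f::{field,finite} vec set"
  assumes C: "C \<subseteq> carrier_vec n" and h: "2 * h \<le> n" and d: "4 < min_distance C"
  shows "card C * (h * (CARD('f) - 1))\<^sup>2 \<le> CARD('f) ^ n"
proof -
  define E where
    "E = (\<lambda>((i, a), (j, b)). vec n (\<lambda>k. if k = i then a else if k = j then b else (0 :: 'f)))"
  define P where "P = ({..<h} \<times> (UNIV - {0 :: 'f})) \<times> ({h..<2 * h} \<times> (UNIV - {0 :: 'f}))"
  have inj: "c = c' \<and> p = p'"
    if c: "c \<in> C" "c' \<in> C" and p: "p \<in> P" "p' \<in> P" and eq: "c + E p = c' + E p'" for c c' p p'
  proof -
    obtain i a j b where P: "p = ((i, a), (j, b))" by (cases p) auto
    obtain i' a' j' b' where P': "p' = ((i', a'), (j', b'))" by (cases p') auto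
    have dim: "dim_vec c = n" "dim_vec c' = n" using c C by auto
    have Ek: "E p $ k = (if k = i then a else if k = j then b else 0)"
      "E p' $ k = (if k = i' then a' else if k = j' then b' else 0)" if "k < n" for k
      using that by (simp_all add: E_def P P')
    have dimE: "dim_vec (E p) = n" "dim_vec (E p') = n" by (simp_all add: E_def P P')
    have eqk: "c $ k + E p $ k = c' $ k + E p' $ k" if "k < n" for k
      using arg_cong[OF eq, of "\<lambda>v. v $ k"] that dim dimE by simp
    have "c = c'"
    proof (rule ccontr)
      assume "c \<noteq> c'"
      \<comment> \<open>The two sums agree, so wherever the codewords differ the errors differ as
        well, which is possible only at the positions carrying an error.\<close>
      have "{k. k < dim_vec c \<and> c $ k \<noteq> c' $ k} \<subseteq> {i, j, i', j'}"
      proof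
        fix k assume "k \<in> {k. k < dim_vec c \<and> c $ k \<noteq> c' $ k}"
        then show "k \<in> {i, j, i', j'}" using eqk[of k] Ek[of k] dim by (auto split: if_splits)
      qed
      then have "hamming_dist c c' \<le> card {i, j, i', j'}"
        unfolding hamming_dist_def by (intro card_mono) auto
      also have "\<dots> \<le> 4" by (simp add: card_insert_if)
      finally show False using min_distance_le[OF c \<open>c \<noteq> c'\<close>] d by simp
    qed
    moreover have "p = p'"
    proof -
      have r: "i < h" "h \<le> j" "j < 2 * h" "a \<noteq> 0" "b \<noteq> 0" "i' < h" "h \<le> j'" "j' < 2 * h"
        using p by (auto simp: P P' P_def)
      then have n: "i < n" "j < n" using h by auto
      \<comment> \<open>Equal codewords leave equal errors. The two halves are disjoint, so
        \<open>i\<close> is not \<open>j'\<close> and \<open>j\<close> is not \<open>i'\<close>;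
        nonzero entries then force equal positions.\<close>
      have "a = (if i = i' then a' else if i = j' then b' else 0)"
        using eqk[OF n(1)] Ek[OF n(1)] \<open>c = c'\<close> by simp
      moreover have "b = (if j = i' then a' else if j = j' then b' else 0)"
        using eqk[OF n(2)] Ek[OF n(2)] \<open>c = c'\<close> r(1,2) by simp
      ultimately have "i = i' \<and> a = a'" "j = j' \<and> b = b'"
        using r by (simp_all split: if_splits)
      then show ?thesis by (simp add: P P')
    qed
    ultimately show ?thesis by simp
  qed
  have "inj_on (\<lambda>(c, p). c + E p) (C \<times> P)"
  proof (rule inj_onI, clarify)
    fix c p c' p' assume "c \<in> C" "c' \<in> C" "p \<in> P" "p' \<in> P" "c + E p = c' + E p'"
    then show "c = c' \<and> p = p'" by (rule inj)
  qed
  then have "card (C \<times> P) = card ((\<lambda>(c, p). c + E p) ` (C \<times> P))" by (rule card_image[symmetric])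
  also have "\<dots> \<le> card (carrier_vec n :: 'f vec set)"
  proof (rule card_mono)
    show "finite (carrier_vec n :: 'f vec set)"
      using card_carrier_vec[where 'f = 'f, of n] by (intro card_ge_0_finite) simp
    show "(\<lambda>(c, p). c + E p) ` (C \<times> P) \<subseteq> carrier_vec n"
      using C by (auto simp: E_def)
  qed
  finally show ?thesis
    by (simp add: P_def card_cartesian_product card_carrier_vec card_Diff_singleton power2_eq_square)
qed

section \<open>Minimal polynomials over a finite field\<close>

locale finite_field_extension = field_hom \<iota>
  for \<iota> :: "'f::{field,finite} \<Rightarrow> 'a::{field,finite}"
begin

sublocale map_poly_hom: map_poly_comm_ring_hom \<iota> ..

abbreviation eval_at :: "'a \<Rightarrow> 'f poly \<Rightarrow> 'a" where
  "eval_at \<beta> p \<equiv> poly (map_poly \<iota> p) \<beta>"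

text \<open>The predicate under \<open>THE\<close> in \<open>min_poly\<close>, named so that
  existence and uniqueness can be shown for it and passed to \<open>theI'\<close>.\<close>

definition is_min_poly :: "'a \<Rightarrow> 'f poly \<Rightarrow> bool" where
  "is_min_poly \<beta> p \<longleftrightarrow> lead_coeff p = 1 \<and> eval_at \<beta> p = 0 \<and>
     (\<forall>q. q \<noteq> 0 \<and> eval_at \<beta> q = 0 \<longrightarrow> degree p \<le> degree q)"

text \<open>In a finite field two powers of \<open>\<beta>\<close> coincide, so some x^i - x^j
  vanishes there.\<close>

lemma ex_annihilating_poly: "\<exists>p. p \<noteq> 0 \<and> eval_at \<beta> p = 0"
proof -
  have "\<not> inj (\<lambda>k::nat. \<beta> ^ k)"
    using finite_imageD[of "\<lambda>k::nat. \<beta> ^ k" UNIV] by auto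
  then obtain i j :: nat where "i \<noteq> j" "\<beta> ^ i = \<beta> ^ j" by (auto simp: inj_def)
  then have "monom 1 i - monom 1 j \<noteq> (0 :: 'f poly)" "eval_at \<beta> (monom 1 i - monom 1 j) = 0"
    by (auto simp: hom_distribs poly_monom monom_eq_iff')
  then show ?thesis by blast
qed

text \<open>Two monic candidates have equal degree, so their leading terms cancel in the difference.
  A nonzero difference would vanish at \<open>\<beta>\<close> in smaller degree.\<close>

lemma is_min_poly_unique:
  assumes "is_min_poly \<beta> p" and "is_min_poly \<beta> q"
  shows "p = q"
proof (rule ccontr)
  assume "p \<noteq> q"
  have nz: "p \<noteq> 0" "q \<noteq> 0" using assms by (auto simp: is_min_poly_def)
  then have deg: "degree p = degree q"
    using assms by (auto simp: is_min_poly_def intro: le_antisym)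
  have "degree p \<le> degree (p - q)"
    using assms \<open>p \<noteq> q\<close> by (auto simp: is_min_poly_def hom_distribs)
  moreover have "degree (p - q) \<le> degree p"
    using degree_diff_le_max[of p q] deg by simp
  ultimately have "degree (p - q) = degree p" by simp
  then have "lead_coeff (p - q) = lead_coeff p - lead_coeff q" using deg by simp
  also have "\<dots> = 0" using assms by (simp add: is_min_poly_def)
  finally have "p - q = 0" by (rule leading_coeff_0_iff[THEN iffD1])
  then show False using \<open>p \<noteq> q\<close> by simp
qed

lemma ex_is_min_poly: "\<exists>p. is_min_poly \<beta> p"
proof -
  define P where "P = (\<lambda>p. p \<noteq> 0 \<and> eval_at \<beta> p = 0)"
  obtain p0 where "P p0" unfolding P_def using ex_annihilating_poly by blast
  from ex_has_least_nat[of P, OF this, of degree]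
  obtain p where p: "P p" "\<And>q. P q \<Longrightarrow> degree p \<le> degree q" by blast
  let ?p = "Polynomial.smult (inverse (lead_coeff p)) p"
  have "lead_coeff ?p = 1" and "degree ?p = degree p" and "eval_at \<beta> ?p = 0"
    using p(1) by (simp_all add: P_def map_poly_hom_smult)
  with p(2) have "is_min_poly \<beta> ?p" unfolding is_min_poly_def P_def by metis
  then show ?thesis by blast
qed

lemma is_min_poly_min_poly: "is_min_poly \<beta> (min_poly \<iota> \<beta>)"
proof -
  have "\<exists>!p. is_min_poly \<beta> p" using ex_is_min_poly is_min_poly_unique by blast
  from theI'[OF this] show ?thesis unfolding min_poly_def is_min_poly_def .
qed

lemma lead_coeff_min_poly [simp]: "lead_coeff (min_poly \<iota> \<beta>) = 1"
  and eval_min_poly [simp]: "eval_at \<beta> (min_poly \<iota> \<beta>) = 0"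
  and degree_min_poly_le: "q \<noteq> 0 \<Longrightarrow> eval_at \<beta> q = 0 \<Longrightarrow> degree (min_poly \<iota> \<beta>) \<le> degree q"
  using is_min_poly_min_poly[of \<beta>] by (auto simp: is_min_poly_def)

lemma min_poly_nonzero [simp]: "min_poly \<iota> \<beta> \<noteq> 0"
  using lead_coeff_min_poly[of \<beta>] by (metis leading_coeff_0_iff zero_neq_one)

lemma eval_mod_min_poly: "eval_at \<beta> (p mod min_poly \<iota> \<beta>) = eval_at \<beta> p"
proof -
  have "eval_at \<beta> p = eval_at \<beta> (p div min_poly \<iota> \<beta> * min_poly \<iota> \<beta> + p mod min_poly \<iota> \<beta>)"
    by (simp only: div_mult_mod_eq)
  also have "\<dots> = eval_at \<beta> (p mod min_poly \<iota> \<beta>)"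
    by (simp only: map_poly_hom.hom_add map_poly_hom.hom_mult poly_add poly_mult eval_min_poly) simp
  finally show ?thesis by simp
qed

lemma degree_mod_min_poly:
  "p mod min_poly \<iota> \<beta> = 0 \<or> degree (p mod min_poly \<iota> \<beta>) < degree (min_poly \<iota> \<beta>)"
  by (rule degree_mod_less) simp

lemma min_poly_dvd_iff: "min_poly \<iota> \<beta> dvd p \<longleftrightarrow> eval_at \<beta> p = 0"
proof
  assume "eval_at \<beta> p = 0"
  then have "p mod min_poly \<iota> \<beta> = 0"
    using degree_min_poly_le[where q = "p mod min_poly \<iota> \<beta>" and \<beta> = \<beta>]
      degree_mod_min_poly[where p = p and \<beta> = \<beta>] eval_mod_min_poly[where p = p and \<beta> = \<beta>] by (metis leD)
  then show "min_poly \<iota> \<beta> dvd p" by (rule dvd_eq_mod_eq_0[THEN iffD2])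
next
  assume "min_poly \<iota> \<beta> dvd p"
  then obtain h where "p = min_poly \<iota> \<beta> * h" by (rule dvdE)
  then show "eval_at \<beta> p = 0" by (simp add: map_poly_hom.hom_mult)
qed

text \<open>Every value at \<open>\<beta>\<close> is taken by exactly one remainder modulo the
  minimal polynomial. Degrees of minimal polynomials thus follow from the size of the subring
  generated by \<open>\<beta>\<close>.\<close>

lemma card_range_eval: "card (range (eval_at \<beta>)) = CARD('f) ^ degree (min_poly \<iota> \<beta>)"
proof -
  let ?P = "{p :: 'f poly. p = 0 \<or> degree p < degree (min_poly \<iota> \<beta>)}"
  have "inj_on (eval_at \<beta>) ?P"
  proof (rule inj_onI, rule ccontr)
    fix p q assume pq: "p \<in> ?P" "q \<in> ?P" "eval_at \<beta> p = eval_at \<beta> q" "p \<noteq> q"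
    then have "degree (min_poly \<iota> \<beta>) \<le> degree (p - q)"
      by (intro degree_min_poly_le) (simp_all add: map_poly_hom.hom_minus)
    moreover have "degree (p - q) < degree (min_poly \<iota> \<beta>)"
      using pq degree_diff_le_max[of p q] by auto
    ultimately show False by simp
  qed
  then have "card ?P = card (eval_at \<beta> ` ?P)" by (rule card_image[symmetric])
  also have "eval_at \<beta> ` ?P = range (eval_at \<beta>)"
  proof -
    have "eval_at \<beta> p \<in> eval_at \<beta> ` ?P" for p
      using degree_mod_min_poly[where p = p and \<beta> = \<beta>]
        eval_mod_min_poly[where p = p and \<beta> = \<beta>] image_eqI[of _ "eval_at \<beta>" "p mod min_poly \<iota> \<beta>" ?P]
      by simp
    then show ?thesis by blast
  qed
  finally show ?thesis by (simp add: card_poly_degree_less)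
qed

lemma eval_word_poly:
  assumes "c \<in> carrier_vec n"
  shows "eval_at \<beta> (word_poly c) = (\<Sum>i<n. \<iota> (c $ i) * \<beta> ^ i)"
proof -
  have "word_poly c = (\<Sum>i<n. monom (c $ i) i)"
    by (rule poly_eqI) (simp add: coeff_word_poly[OF assms] coeff_sum)
  then show ?thesis by (simp add: map_poly_hom.hom_sum poly_sum poly_monom)
qed

end

section \<open>Words of weight at most three\<close>

text \<open>Translation by 1 permutes the ring, so summing over all elements shows that as many ones
  as there are elements add up to 0. For 3^m elements this gives characteristic 3.\<close>

lemma of_nat_card_eq_0: "of_nat CARD('a::{ring_1,finite}) = (0 :: 'a)"
proof -
  have "(\<Sum>x\<in>UNIV. x + 1) = (\<Sum>x\<in>UNIV. x :: 'a)"
    by (rule sum.reindex_bij_witness[of _ "\<lambda>x. x - 1" "\<lambda>x. x + 1"]) auto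
  then show ?thesis by (simp add: sum.distrib)
qed

text \<open>The mixed terms of a cube carry the factor 3; the rest is iteration.\<close>

lemma frobenius_add:
  fixes x y :: "'a::comm_ring_1"
  assumes "(3 :: 'a) = 0"
  shows "(x + y) ^ 3 ^ k = x ^ 3 ^ k + y ^ 3 ^ k"
proof (induction k)
  case (Suc k)
  have cube: "(a + b) ^ 3 = a ^ 3 + b ^ 3" for a b :: 'a
  proof -
    have "(a + b) ^ 3 = a ^ 3 + b ^ 3 + 3 * (a\<^sup>2 * b + a * b\<^sup>2)"
      by (simp add: power2_eq_square power3_eq_cube algebra_simps)
    then show ?thesis using assms by simp
  qed
  have "(x + y) ^ 3 ^ Suc k = ((x + y) ^ 3 ^ k) ^ 3" by (simp add: power_mult[symmetric] mult.commute)
  also have "\<dots> = x ^ 3 ^ Suc k + y ^ 3 ^ Suc k"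
    unfolding Suc.IH cube by (simp add: power_mult[symmetric] mult.commute)
  finally show ?case .
qed simp

lemma double_eq_0_char_3:
  fixes a :: "'a::comm_ring_1"
  assumes "(3 :: 'a) = 0" and "a + a = 0"
  shows "a = 0"
proof -
  have "3 * a = (a + a) + a" by simp
  then show ?thesis unfolding assms by simp
qed

text \<open>Here s = (q^2 - 1) / 2 and t = (q + 1) / 2. The latter is odd exactly when q is 1 modulo
  4, that is, when \<open>j\<close> is even; this is where divisibility of m by 4 enters. The field
  is arbitrary of characteristic 3, its size being reflected only in hypotheses that s-th powers
  square to 1.\<close>

context
  fixes q s t j :: nat
  assumes q: "q = 3 ^ j" and t: "q + 1 = 2 * t" "odd t" and s: "s = (q - 1) * t"
begin

text \<open>The exponent \<open>s\<close> is that of the quadratic character.  If the character of \<open>y3\<close> agrees with the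
  common one of \<open>y1, y2\<close>, the second equation factors as \<open>(y1 - y2) ^ (q + 1) = 0\<close>; otherwise it
  becomes \<open>y1 ^ q * y2 + y1 * y2 ^ q = 0\<close>, so \<open>(y1 / y2) ^ (q - 1) = -1\<close>, and raising this to the
  odd power \<open>t\<close> shows that \<open>y1 / y2\<close> is a nonsquare.\<close>

lemma norm_equations_imp_eq:
  fixes y1 y2 y3 :: "'a::field"
  assumes three: "(3 :: 'a) = 0"
    and lin: "y1 + y2 + y3 = 0"
    and norm: "y1 ^ s * y1 ^ (q + 1) + y2 ^ s * y2 ^ (q + 1) + y3 ^ s * y3 ^ (q + 1) = 0"
    and nz: "y1 \<noteq> 0" "y2 \<noteq> 0"
    and sgn: "(y2 ^ s)\<^sup>2 = 1" "(y3 ^ s)\<^sup>2 = 1" "y1 ^ s = y2 ^ s"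
  shows "y1 = y2"
proof -
  define A B where "A = y1 ^ q" and "B = y2 ^ q"
  have q0: "q > 0" using q by simp
  have "even (q + 1)" using t by simp
  have "y3 = - (y1 + y2)" using lin by (simp only: eq_neg_iff_add_eq_0 add_ac)
  then have "y3 ^ (q + 1) = (y1 + y2) ^ (q + 1)" using \<open>even (q + 1)\<close> by (simp only: power_minus_even)
  also have "\<dots> = (A + B) * (y1 + y2)"
    unfolding power_add A_def B_def q frobenius_add[OF three] by simp
  finally have y3: "y3 ^ (q + 1) = (A + B) * (y1 + y2)" .
  have y12: "y1 ^ (q + 1) = A * y1" "y2 ^ (q + 1) = B * y2" by (simp_all add: A_def B_def)
  have \<eta>0: "y2 ^ s \<noteq> 0" using nz by simp
  have "(y2 ^ s)\<^sup>2 = (y3 ^ s)\<^sup>2" using sgn by simp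
  then consider "y3 ^ s = y2 ^ s" | "y3 ^ s = - (y2 ^ s)" by (auto simp: power2_eq_iff)
  then show ?thesis
  proof cases
    case 1
    then have "y2 ^ s * (A * y1 + B * y2 + (A + B) * (y1 + y2)) = 0"
      using norm unfolding y3 y12 sgn(3) by (simp only: distrib_left)
    then have "A * y1 + B * y2 + (A + B) * (y1 + y2) = 0" using \<eta>0 by (simp only: mult_eq_0_iff simp_thms)
    \<comment> \<open>Modulo 3 the coefficients 2 become -1, so the vanishing sum is minus this
      product. By the Frobenius map A - B = (y1 - y2)^q.\<close>
    moreover have "(A - B) * (y1 - y2) =
        3 * (A * y1 + B * y2) - (A * y1 + B * y2 + (A + B) * (y1 + y2))"
      by (simp add: algebra_simps)
    ultimately have "(A - B) * (y1 - y2) = 0" using three by simp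
    moreover have "A = B + (y1 - y2) ^ q"
      using frobenius_add[OF three, of y2 "y1 - y2" j] by (simp add: A_def B_def q)
    ultimately show ?thesis by auto
  next
    case 2
    then have "y2 ^ s * (A * y1 + B * y2 - (A + B) * (y1 + y2)) = 0"
      using norm unfolding y3 y12 sgn(3) by (simp add: algebra_simps)
    then have "A * y1 + B * y2 - (A + B) * (y1 + y2) = 0" using \<eta>0 by (simp only: mult_eq_0_iff simp_thms)
    moreover have "A * y1 + B * y2 - (A + B) * (y1 + y2) = - (A * y2 + B * y1)"
      by (simp add: algebra_simps)
    ultimately have "A * y2 + B * y1 = 0" by (simp only: neg_equal_0_iff_equal)
    then have "A * y2 = - (B * y1)" by (simp only: eq_neg_iff_add_eq_0)
    moreover have "A = y1 ^ (q - 1) * y1" "B = y2 ^ (q - 1) * y2"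
      unfolding A_def B_def using q0 by (simp_all only: power_minus_mult)
    ultimately have "y1 ^ (q - 1) * (y1 * y2) = - (y2 ^ (q - 1)) * (y1 * y2)" by (simp add: mult_ac)
    then have "y1 ^ (q - 1) = - (y2 ^ (q - 1))" using nz by (simp only: mult_cancel_right) simp
    then have "y1 ^ s = - (y2 ^ s)"
      unfolding s power_mult using \<open>odd t\<close> by (simp add: power_minus_odd)
    \<comment> \<open>A nonzero element of characteristic 3 is not its own negative, so this case is
      contradictory.\<close>
    with sgn(3) have "y2 ^ s = - (y2 ^ s)" by simp
    then have "y2 ^ s + y2 ^ s = 0" by (simp only: eq_neg_iff_add_eq_0)
    then show ?thesis using double_eq_0_char_3[OF three] \<eta>0 by blast
  qed
qed

lemma no_weight_three:
  fixes x1 x2 x3 u1 u2 u3 :: "'a::field"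
  assumes three: "(3 :: 'a) = 0"
    and u: "u1\<^sup>2 = 1" "u2\<^sup>2 = 1" "u3\<^sup>2 = 1"
    and x: "(x1 ^ s)\<^sup>2 = 1" "(x2 ^ s)\<^sup>2 = 1" "(x3 ^ s)\<^sup>2 = 1"
    and nz: "x1 \<noteq> 0" "x2 \<noteq> 0" "x3 \<noteq> 0"
    and ne: "x1 \<noteq> x2" "x1 \<noteq> x3" "x2 \<noteq> x3"
    and lin: "u1 * x1 + u2 * x2 + u3 * x3 = 0"
    and norm: "u1 * x1 ^ (q + 1) + u2 * x2 ^ (q + 1) + u3 * x3 ^ (q + 1) = 0"
    and sgn: "u1 * x1 ^ s + u2 * x2 ^ s + u3 * x3 ^ s = 0"
  shows False
proof -
  have three': "(1 :: 'a) + 1 + 1 = 0" using three by simp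
  have sq: "a = 1 \<or> a = - 1" if "a\<^sup>2 = 1" for a :: 'a using that by (simp add: power2_eq_1_iff)
  \<comment> \<open>Multiplying \<open>x\<close> by its sign \<open>x ^ s\<close> changes neither
    the s-th nor the (q + 1)-th power, since both exponents are even. The substitution is injective
    because the sign can be recovered.\<close>
  define y where "y = (\<lambda>x :: 'a. x ^ s * x)"
  have s2: "even s" "even (q + 1)" using t s by auto
  have y: "y x ^ s = x ^ s \<and> y x ^ (q + 1) = x ^ (q + 1)" if "(x ^ s)\<^sup>2 = 1" for x
    using sq[OF that] s2 by (auto simp: y_def power_mult_distrib power_minus_even)
  have inj: "x = x'" if "y x = y x'" "(x ^ s)\<^sup>2 = 1" "(x' ^ s)\<^sup>2 = 1" "x \<noteq> 0" for x x'
    using that y[of x] y[of x'] by (auto simp: y_def)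
  \<comment> \<open>In characteristic 3, three signs sum to 0 only if all agree; otherwise the sum
    is again a sign.\<close>
  obtain v where v: "v \<noteq> 0" "u1 * x1 ^ s = v" "u2 * x2 ^ s = v" "u3 * x3 ^ s = v"
  proof (rule that[of "u1 * x1 ^ s"])
    have "(u1 * x1 ^ s)\<^sup>2 = 1" "(u2 * x2 ^ s)\<^sup>2 = 1" "(u3 * x3 ^ s)\<^sup>2 = 1"
      using u x by (simp_all only: power_mult_distrib mult_1)
    from this[THEN sq] show "u2 * x2 ^ s = u1 * x1 ^ s" "u3 * x3 ^ s = u1 * x1 ^ s"
      using sgn three' by auto
    show "u1 * x1 ^ s \<noteq> 0" using \<open>(u1 * x1 ^ s)\<^sup>2 = 1\<close> by (metis zero_power2 zero_neq_one)
  qed simp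
  have uv: "u * z = v * (x ^ s * z)" if "u * x ^ s = v" "(x ^ s)\<^sup>2 = 1" for u x z
  proof -
    have "v * (x ^ s * z) = u * (x ^ s)\<^sup>2 * z"
      unfolding that(1)[symmetric] by (simp only: power2_eq_square mult_ac)
    then show ?thesis by (simp only: that(2) mult_1_right)
  qed
  have "v * (y x1 + y x2 + y x3) = 0"
    using lin uv[OF v(2) x(1), of x1] uv[OF v(3) x(2), of x2] uv[OF v(4) x(3), of x3]
    by (simp add: distrib_left y_def)
  then have L: "y x1 + y x2 + y x3 = 0" using v(1) by simp
  have "v * (x1 ^ s * x1 ^ (q + 1) + x2 ^ s * x2 ^ (q + 1) + x3 ^ s * x3 ^ (q + 1)) = 0"
    using norm uv[OF v(2) x(1), of "x1 ^ (q + 1)"] uv[OF v(3) x(2), of "x2 ^ (q + 1)"]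
      uv[OF v(4) x(3), of "x3 ^ (q + 1)"] by (simp only: distrib_left)
  then have N: "y x1 ^ s * y x1 ^ (q + 1) + y x2 ^ s * y x2 ^ (q + 1) + y x3 ^ s * y x3 ^ (q + 1) = 0"
    using v(1) y[OF x(1)] y[OF x(2)] y[OF x(3)] by simp
  have Y: "(y x1 ^ s)\<^sup>2 = 1" "(y x2 ^ s)\<^sup>2 = 1" "(y x3 ^ s)\<^sup>2 = 1"
    "y x1 \<noteq> 0" "y x2 \<noteq> 0" "y x3 \<noteq> 0"
    using x y[OF x(1)] y[OF x(2)] y[OF x(3)] nz by (simp_all add: y_def)
  \<comment> \<open>Two of three signs coincide; the equations are symmetric, so that pair may be
    listed first.\<close>
  consider "y x1 ^ s = y x2 ^ s" | "y x1 ^ s = y x3 ^ s" | "y x2 ^ s = y x3 ^ s"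
    using Y(1-3)[THEN sq] by auto
  then show False
  proof cases
    case 1
    from norm_equations_imp_eq[OF three L N Y(4,5) Y(2,3) 1] show False
      using inj ne x nz by blast
  next
    case 2
    have "y x1 + y x3 + y x2 = 0"
      "y x1 ^ s * y x1 ^ (q + 1) + y x3 ^ s * y x3 ^ (q + 1) + y x2 ^ s * y x2 ^ (q + 1) = 0"
      using L N by (simp_all only: add_ac)
    from norm_equations_imp_eq[OF three this Y(4,6) Y(3,2) 2] show False
      using inj ne x nz by blast
  next
    case 3
    have "y x2 + y x3 + y x1 = 0"
      "y x2 ^ s * y x2 ^ (q + 1) + y x3 ^ s * y x3 ^ (q + 1) + y x1 ^ s * y x1 ^ (q + 1) = 0"
      using L N by (simp_all only: add_ac)
    from norm_equations_imp_eq[OF three this Y(5,6) Y(3,1) 3] show False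
      using inj ne x nz by blast
  qed
qed

text \<open>One term alone cannot vanish. With two terms, the linear equation and distinctness force
  equal coefficients and opposite locators; as q + 1 is even, the norm equation then doubles a
  nonzero element.\<close>

lemma no_light_word:
  fixes f x :: "'i \<Rightarrow> 'a::field"
  assumes three: "(3 :: 'a) = 0"
    and S: "S \<noteq> {}" "finite S" "card S \<le> 3"
    and f: "\<And>i. i \<in> S \<Longrightarrow> (f i)\<^sup>2 = 1"
    and x: "\<And>i. i \<in> S \<Longrightarrow> x i \<noteq> 0" "\<And>i. i \<in> S \<Longrightarrow> (x i ^ s)\<^sup>2 = 1" "inj_on x S"
    and lin: "(\<Sum>i\<in>S. f i * x i) = 0"
    and norm: "(\<Sum>i\<in>S. f i * x i ^ (q + 1)) = 0"
    and sgn: "(\<Sum>i\<in>S. f i * x i ^ s) = 0"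
  shows False
proof -
  have sq: "a = 1 \<or> a = - 1" if "a\<^sup>2 = 1" for a :: 'a using that by (simp add: power2_eq_1_iff)
  have "card S \<noteq> 0" using S by simp
  then consider "card S = 1" | "card S = 2" | "card S = 3" using S(3) by linarith
  then show False
  proof cases
    case 1
    then obtain i where "S = {i}" by (rule card_1_singletonE)
    then show False using lin x(1) f[of i] by auto
  next
    case 2
    then obtain i k where ik: "S = {i, k}" "i \<noteq> k" by (auto simp: card_2_iff)
    have ne: "x i \<noteq> x k" using ik x(3) by (auto simp: inj_on_def)
    have eq: "f i * x i + f k * x k = 0" "f i * x i ^ (q + 1) + f k * x k ^ (q + 1) = 0"
      using lin norm ik by simp_all
    have fs: "f i = 1 \<or> f i = - 1" "f k = 1 \<or> f k = - 1" using sq f ik by auto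
    then have fi0: "f i \<noteq> 0" by auto
    from fs consider "f k = f i" | "f k = - f i" by auto
    then have "f k = f i \<and> x k = - x i"
    proof cases
      case 1
      then have "f i * (x i + x k) = 0" using eq(1) by (simp only: distrib_left)
      then have "x i + x k = 0" using fi0 by simp
      then show ?thesis using 1 by (simp only: add_eq_0_iff)
    next
      case 2
      then have "f i * (x i - x k) = 0" using eq(1) by (simp add: algebra_simps)
      then show ?thesis using fi0 ne by simp
    qed
    then have "x k = - x i" "f k = f i" by blast+
    moreover have "even (q + 1)" using t by simp
    ultimately have "f i * (x i ^ (q + 1) + x i ^ (q + 1)) = 0"
      using eq(2) by (simp only: power_minus_even distrib_left)
    then have "x i ^ (q + 1) + x i ^ (q + 1) = 0" using fi0 by (simp only: mult_eq_0_iff simp_thms)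
    then have "x i ^ (q + 1) = 0" by (rule double_eq_0_char_3[OF three])
    then show False using x(1) ik by simp
  next
    case 3
    then obtain i k l where ikl: "S = {i, k, l}" "i \<noteq> k" "i \<noteq> l" "k \<noteq> l" by (auto simp: card_3_iff)
    have ne: "x i \<noteq> x k" "x i \<noteq> x l" "x k \<noteq> x l" using ikl x(3) by (auto simp: inj_on_def)
    have sums: "(\<Sum>a\<in>S. g a) = g i + g k + g l" for g :: "'i \<Rightarrow> 'a"
      using ikl by (simp add: add.assoc)
    show False
      by (rule no_weight_three[OF three f f f x(2) x(2) x(2) x(1) x(1) x(1) ne
            lin[unfolded sums] norm[unfolded sums] sgn[unfolded sums]]) (simp_all add: ikl(1))
  qed
qed

end

section \<open>Primitive elements and the degrees of the minimal polynomials\<close>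

text \<open>Multiplication by \<open>x\<close> permutes the nonzero elements; compare their
  products.\<close>

lemma power_card_minus_1:
  fixes x :: "'a::{field,finite}"
  assumes "x \<noteq> 0"
  shows "x ^ (CARD('a) - 1) = 1"
proof -
  have "(\<Prod>y\<in>UNIV - {0}. x * y) = (\<Prod>y\<in>UNIV - {0}. y)"
    by (rule prod.reindex_bij_witness[of _ "\<lambda>y. y / x" "\<lambda>y. x * y"]) (use assms in auto)
  then have "x ^ (CARD('a) - 1) * (\<Prod>y\<in>UNIV - {0}. y) = (\<Prod>y\<in>UNIV - {0}. y :: 'a)"
    by (simp add: prod.distrib card_Diff_singleton)
  moreover have "(\<Prod>y\<in>UNIV - {0}. y :: 'a) \<noteq> 0" by (simp add: prod_zero_iff)
  ultimately show ?thesis by simp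
qed

locale primitive_element =
  fixes \<alpha> :: "'a::{field,finite}"
  assumes generator: "mult_generator \<alpha>"
begin

lemma alpha_nonzero: "\<alpha> \<noteq> 0"
proof -
  have "\<alpha> powi 1 \<in> range (\<lambda>k::int. \<alpha> powi k)" by blast
  then show ?thesis using generator by (simp add: mult_generator_def)
qed

lemma card_minus_1_pos: "0 < CARD('a) - 1"
proof -
  have "card {0 :: 'a, 1} \<le> CARD('a)" by (rule card_mono) auto
  then show ?thesis by simp
qed

lemma power_alpha_mod: "\<alpha> ^ (i mod (CARD('a) - 1)) = \<alpha> ^ i"
proof -
  let ?n = "CARD('a) - 1"
  have "\<alpha> ^ i = \<alpha> ^ (?n * (i div ?n) + i mod ?n)" by simp
  also have "\<dots> = \<alpha> ^ (i mod ?n)"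
    unfolding power_add power_mult power_card_minus_1[OF alpha_nonzero] by simp
  finally show ?thesis by simp
qed

lemma power_alpha_image: "(\<lambda>i. \<alpha> ^ i) ` {..<CARD('a) - 1} = UNIV - {0}"
proof (intro equalityI subsetI)
  fix x :: 'a assume "x \<in> UNIV - {0}"
  then obtain k :: int where k: "x = \<alpha> powi k"
    using generator unfolding mult_generator_def by blast
  have "\<exists>i::nat. x = \<alpha> ^ i"
  proof (cases "k \<ge> 0")
    case True
    then show ?thesis using k by (metis nonneg_int_cases power_int_of_nat)
  next
    case False
    let ?n = "CARD('a) - 1"
    \<comment> \<open>With n nonzero elements, the inverse of \<open>\<alpha>\<close> is its (n -
      1)-th power, which removes negative exponents.\<close>
    have "nat (- k) + nat (- k) * (?n - 1) = ?n * nat (- k)"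
      using card_minus_1_pos by (cases ?n) simp_all
    then have "\<alpha> ^ (nat (- k)) * \<alpha> ^ (nat (- k) * (?n - 1)) = (\<alpha> ^ ?n) ^ nat (- k)"
      by (simp only: power_add[symmetric] power_mult[symmetric])
    then have "\<alpha> ^ (nat (- k)) * \<alpha> ^ (nat (- k) * (?n - 1)) = 1"
      by (simp only: power_card_minus_1[OF alpha_nonzero] power_one)
    then have "inverse (\<alpha> ^ nat (- k)) = \<alpha> ^ (nat (- k) * (?n - 1))" by (rule inverse_unique)
    moreover have "x = inverse (\<alpha> ^ nat (- k))"
      using False k by (simp add: power_int_def power_inverse)
    ultimately show ?thesis by blast
  qed
  then obtain i where "x = \<alpha> ^ (i mod (CARD('a) - 1))" using power_alpha_mod by metis
  then show "x \<in> (\<lambda>i. \<alpha> ^ i) ` {..<CARD('a) - 1}" using card_minus_1_pos by auto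
qed (use alpha_nonzero in auto)

lemma inj_on_power_alpha: "inj_on (\<lambda>i. \<alpha> ^ i) {..<CARD('a) - 1}"
  by (rule eq_card_imp_inj_on) (simp_all add: power_alpha_image card_Diff_singleton del: One_nat_def)

lemma power_alpha_eq_1_iff: "\<alpha> ^ i = 1 \<longleftrightarrow> CARD('a) - 1 dvd i"
proof -
  let ?n = "CARD('a) - 1"
  have "\<alpha> ^ i = 1 \<longleftrightarrow> \<alpha> ^ (i mod ?n) = \<alpha> ^ 0" by (simp add: power_alpha_mod del: One_nat_def)
  also have "\<dots> \<longleftrightarrow> i mod ?n = 0"
    using inj_on_power_alpha card_minus_1_pos by (subst inj_on_eq_iff[OF inj_on_power_alpha]) auto
  finally show ?thesis by (simp add: dvd_eq_mod_eq_0)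
qed

end

section \<open>Exponents 1, q + 1 and s in the field with 3^m elements\<close>

locale ternary_code_field = finite_field_extension \<iota> + primitive_element \<alpha>
  for \<iota> :: "'f::{field,finite} \<Rightarrow> 'a::{field,finite}" and \<alpha> :: 'a +
  fixes m q s t :: nat
  assumes card_base: "CARD('f) = 3" and card_ext: "CARD('a) = 3 ^ m"
    and q: "q = 3 ^ (m div 2)" and m: "even m" "m \<ge> 4"
    and t: "q + 1 = 2 * t" "odd t" and s: "s = (q - 1) * t"
begin

lemma three_eq_0: "(3 :: 'a) = 0"
  using of_nat_card_eq_0[where 'a = 'a] by (simp add: card_ext)

lemma code_length_eq: "(3 :: nat) ^ m - 1 = (q - 1) * (q + 1)"
proof -
  have "3 ^ m = q * q" using m(1) by (auto simp: q power_add[symmetric] elim!: evenE)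
  then show ?thesis by (simp add: algebra_simps diff_mult_distrib)
qed

lemma q_ge_9: "q \<ge> 9"
proof -
  have "(3 :: nat) ^ 2 \<le> 3 ^ (m div 2)" using m by (intro power_increasing) auto
  then show ?thesis by (simp add: q)
qed

lemma code_length_eq_2s: "(3 :: nat) ^ m - 1 = 2 * s"
  unfolding code_length_eq t(1) s by simp

text \<open>The order of \<open>\<alpha>\<close> is 2s, so this power is a square root of 1 other
  than 1.\<close>

lemma power_alpha_s: "\<alpha> ^ s = - 1"
proof -
  have "s > 0" using t s q_ge_9 by (auto intro: Nat.gr0I)
  then have "\<not> 2 * s dvd s" by (auto dest: dvd_imp_le)
  then have "\<alpha> ^ s \<noteq> 1" unfolding power_alpha_eq_1_iff card_ext code_length_eq_2s .
  moreover have "(\<alpha> ^ s)\<^sup>2 = 1"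
    unfolding power_mult[symmetric] power_alpha_eq_1_iff card_ext code_length_eq_2s by simp
  ultimately show ?thesis by (simp add: power2_eq_1_iff)
qed

lemma iota_square: "c \<noteq> 0 \<Longrightarrow> (\<iota> c)\<^sup>2 = 1"
  using power_card_minus_1[of c] by (simp add: card_base hom_power[symmetric])

lemma iota_power_q: "\<iota> c ^ q = \<iota> c"
proof -
  have "c ^ 3 = c"
    using power_card_minus_1[of c] by (cases "c = 0") (auto simp: card_base power3_eq_cube power2_eq_square)
  then have "c ^ 3 ^ k = c" for k by (induction k) (simp_all add: power_mult)
  then show ?thesis by (simp add: q hom_power[symmetric])
qed

text \<open>Monomials already take every nonzero value at a primitive element.\<close>

lemma degree_min_poly_alpha: "degree (min_poly \<iota> \<alpha>) = m"
proof -
  have "range (eval_at \<alpha>) = UNIV"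
  proof -
    have "x \<in> range (eval_at \<alpha>)" for x
    proof (cases "x = 0")
      case True
      then have "x = eval_at \<alpha> 0" by simp
      then show ?thesis by blast
    next
      case False
      then obtain i where "x = \<alpha> ^ i" using power_alpha_image by blast
      then have "x = eval_at \<alpha> (monom 1 i)" by (simp add: poly_monom)
      then show ?thesis by blast
    qed
    then show ?thesis by blast
  qed
  then have "(3 :: nat) ^ degree (min_poly \<iota> \<alpha>) = 3 ^ m"
    using card_range_eval[of \<alpha>] by (simp add: card_base card_ext)
  then show ?thesis by simp
qed

text \<open>The element has order q - 1, so polynomial values there are fixed by the q-th power map.
  The fixed points are 0 and the q - 1 powers of the element: the subfield of order q.\<close>

lemma degree_min_poly_norm: "degree (min_poly \<iota> (\<alpha> ^ (q + 1))) = m div 2"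
proof -
  let ?\<beta> = "\<alpha> ^ (q + 1)" and ?S = "(\<lambda>i. (\<alpha> ^ (q + 1)) ^ i) ` {..<q - 1}"
  have q0: "q - 1 > 0" "q > 0" using q_ge_9 by simp_all
  have fixed: "eval_at ?\<beta> p ^ q = eval_at ?\<beta> p" for p
  proof (induction p)
    case 0
    then show ?case using q0 by simp
  next
    case (pCons c p)
    have "?\<beta> ^ (q - 1) = 1"
      by (simp add: power_mult[symmetric] power_alpha_eq_1_iff card_ext code_length_eq mult.commute
          del: power_Suc add_2_eq_Suc' One_nat_def)
    then have "?\<beta> ^ q = ?\<beta>" using q0(2) power_minus_mult[of q ?\<beta>] by simp
    then have "(\<iota> c + ?\<beta> * eval_at ?\<beta> p) ^ q = \<iota> c + ?\<beta> * eval_at ?\<beta> p"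
      using pCons.IH iota_power_q[of c] frobenius_add[OF three_eq_0, of _ _ "m div 2"]
      by (simp only: q[symmetric] power_mult_distrib)
    then show ?case by (simp add: map_poly_pCons_hom)
  qed
  have "range (eval_at ?\<beta>) = insert 0 ?S"
  proof (intro equalityI subsetI)
    fix x assume "x \<in> range (eval_at ?\<beta>)"
    then have xq: "x ^ q = x" using fixed by blast
    show "x \<in> insert 0 ?S"
    proof (cases "x = 0")
      case False
      then obtain i where i: "i < CARD('a) - 1" "x = \<alpha> ^ i" using power_alpha_image by blast
      have "x ^ (q - 1) * x = 1 * x" using xq q0(2) power_minus_mult[of q x] by simp
      then have "x ^ (q - 1) = 1" using False by (simp only: mult_cancel_right simp_thms)
      \<comment> \<open>A fixed nonzero power of \<open>\<alpha>\<close> has exponent divisible by q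
        + 1.\<close>
      then have "(q - 1) * (q + 1) dvd (q - 1) * i"
        by (simp only: i(2) power_mult[symmetric] power_alpha_eq_1_iff card_ext code_length_eq mult.commute)
      then have "q + 1 dvd i" using q0(1) by (simp only: nat_mult_dvd_cancel1)
      then obtain k where k: "i = (q + 1) * k" by (rule dvdE)
      then have "(q + 1) * k < (q + 1) * (q - 1)"
        using i(1) by (simp only: card_ext code_length_eq mult.commute)
      then have "k < q - 1" by (simp only: mult_less_cancel1)
      then show ?thesis using i(2) k by (auto simp only: power_mult)
    qed simp
  next
    fix x assume "x \<in> insert 0 ?S"
    then consider "x = 0" | i where "x = ?\<beta> ^ i" by blast
    then show "x \<in> range (eval_at ?\<beta>)"
    proof cases
      case 1
      then have "x = eval_at ?\<beta> 0" by simp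
      then show ?thesis by blast
    next
      case 2
      then have "x = eval_at ?\<beta> (monom 1 i)" by (simp add: poly_monom)
      then show ?thesis by blast
    qed
  qed
  moreover have "inj_on (\<lambda>i. ?\<beta> ^ i) {..<q - 1}"
  proof (rule inj_onI)
    fix i k assume ik: "i \<in> {..<q - 1}" "k \<in> {..<q - 1}" "?\<beta> ^ i = ?\<beta> ^ k"
    have lt: "(q + 1) * i \<in> {..<CARD('a) - 1}" if "i \<in> {..<q - 1}" for i
    proof -
      have "(q + 1) * i < (q + 1) * (q - 1)" using that by (simp only: mult_less_cancel1) simp
      then show ?thesis by (simp only: card_ext code_length_eq mult.commute lessThan_iff)
    qed
    have "\<alpha> ^ ((q + 1) * i) = \<alpha> ^ ((q + 1) * k)" using ik(3) by (simp only: power_mult)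
    then have "(q + 1) * i = (q + 1) * k"
      by (rule inj_onD[OF inj_on_power_alpha _ lt[OF ik(1)] lt[OF ik(2)]])
    then show "i = k" by (metis mult_cancel1 add_is_0 one_neq_zero)
  qed
  then have "card ?S = q - 1" by (simp only: card_image card_lessThan)
  moreover have "0 \<notin> ?S" using alpha_nonzero by auto
  ultimately have "card (range (eval_at ?\<beta>)) = q"
    using q0 by (simp only: card_insert_disjoint finite_imageI finite_lessThan) simp
  then have "(3 :: nat) ^ degree (min_poly \<iota> ?\<beta>) = 3 ^ (m div 2)"
    using card_range_eval[of ?\<beta>] by (simp add: card_base q)
  then show ?thesis by simp
qed

lemma degree_min_poly_minus_1: "degree (min_poly \<iota> (- 1)) = 1"
proof -
  have "eval_at (- 1) [:1, 1:] = 0" by (simp add: map_poly_pCons_hom)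
  then have "degree (min_poly \<iota> (- 1)) \<le> 1"
    using degree_min_poly_le[where q = "[:1, 1:]" and \<beta> = "- 1"] by simp
  moreover have "degree (min_poly \<iota> (- 1)) \<noteq> 0"
  proof
    assume "degree (min_poly \<iota> (- 1)) = 0"
    then obtain c where c: "min_poly \<iota> (- 1) = [:c:]" by (rule degree_eq_zeroE)
    then show False
      using lead_coeff_min_poly[of "- 1"] eval_min_poly[of "- 1"] by (simp add: map_poly_pCons_hom)
  qed
  ultimately show ?thesis by simp
qed

end

section \<open>Parameters of the code\<close>

context ternary_code_field
begin

definition gen_poly :: "'f poly" where
  "gen_poly = min_poly \<iota> \<alpha> * (min_poly \<iota> (\<alpha> ^ (q + 1)) * min_poly \<iota> (- 1))"

text \<open>The degrees 1 < m/2 < m are distinct, so an element with the larger degree is not a root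
  of a minimal polynomial of smaller degree. The factors can therefore be split off in increasing
  degree.\<close>

lemma gen_poly_dvd_iff:
  "gen_poly dvd p \<longleftrightarrow>
     eval_at \<alpha> p = 0 \<and> eval_at (\<alpha> ^ (q + 1)) p = 0 \<and> eval_at (- 1) p = 0"
proof
  assume "gen_poly dvd p"
  then obtain h where "p = gen_poly * h" by (rule dvdE)
  then show "eval_at \<alpha> p = 0 \<and> eval_at (\<alpha> ^ (q + 1)) p = 0 \<and> eval_at (- 1) p = 0"
    by (simp add: gen_poly_def map_poly_hom.hom_mult del: power_Suc add_2_eq_Suc')
next
  assume p: "eval_at \<alpha> p = 0 \<and> eval_at (\<alpha> ^ (q + 1)) p = 0 \<and> eval_at (- 1) p = 0"
  have nz: "eval_at \<beta> f \<noteq> 0" if "f \<noteq> 0" "degree f < degree (min_poly \<iota> \<beta>)" for f \<beta>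
    using degree_min_poly_le[where q = f and \<beta> = \<beta>] that by fastforce
  have m2: "1 < m div 2" "m div 2 < m" "1 < m" using m by auto
  note deg = degree_min_poly_alpha degree_min_poly_norm degree_min_poly_minus_1
  have n1: "eval_at (\<alpha> ^ (q + 1)) (min_poly \<iota> (- 1)) \<noteq> 0"
    and n2: "eval_at \<alpha> (min_poly \<iota> (- 1)) \<noteq> 0"
    and n3: "eval_at \<alpha> (min_poly \<iota> (\<alpha> ^ (q + 1))) \<noteq> 0"
    by (rule nz, simp, simp only: deg m2)+
  from p have "min_poly \<iota> (- 1) dvd p" by (simp only: min_poly_dvd_iff)
  then obtain f where f: "p = min_poly \<iota> (- 1) * f" by (rule dvdE)
  have "eval_at (\<alpha> ^ (q + 1)) f = 0"
    using p n1 by (simp only: f map_poly_hom.hom_mult poly_mult mult_eq_0_iff simp_thms)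
  then have "min_poly \<iota> (\<alpha> ^ (q + 1)) dvd f" by (simp only: min_poly_dvd_iff)
  then obtain h where h: "f = min_poly \<iota> (\<alpha> ^ (q + 1)) * h" by (rule dvdE)
  have "eval_at \<alpha> h = 0"
    using p n2 n3 by (simp only: f h map_poly_hom.hom_mult poly_mult mult_eq_0_iff simp_thms)
  then have "min_poly \<iota> \<alpha> dvd h" by (simp only: min_poly_dvd_iff)
  then obtain r where "h = min_poly \<iota> \<alpha> * r" by (rule dvdE)
  then have "p = gen_poly * r" by (simp only: f h gen_poly_def mult_ac)
  then show "gen_poly dvd p" by simp
qed

lemma lead_coeff_gen_poly: "lead_coeff gen_poly = 1"
  unfolding gen_poly_def lead_coeff_mult lead_coeff_min_poly by simp

lemma degree_gen_poly: "degree gen_poly = m + (m div 2 + 1)"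
  unfolding gen_poly_def by (simp only: degree_mult_eq min_poly_nonzero mult_eq_0_iff simp_thms
      degree_min_poly_alpha degree_min_poly_norm degree_min_poly_minus_1 not_False_eq_True)

lemma gen_poly_dvd_modulus: "gen_poly dvd monom 1 (3 ^ m - 1) - 1"
proof -
  have "eval_at \<beta> (monom 1 (3 ^ m - 1) - 1) = 0" if "\<beta> \<noteq> 0" for \<beta>
    using power_card_minus_1[OF that]
    by (simp add: map_poly_hom.hom_minus poly_monom card_ext del: One_nat_def)
  then show ?thesis using alpha_nonzero by (simp add: gen_poly_dvd_iff)
qed

text \<open>Makes the dimension positive, so that distinct codewords exist and the minimum distance
  is not the default value 0.\<close>

lemma degree_gen_poly_less: "degree gen_poly < 3 ^ m - 1"
proof -
  have "m div 2 < 2 ^ (m div 2)" by (rule less_exp)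
  also have "\<dots> \<le> q" unfolding q by (rule power_mono) simp_all
  finally have "m div 2 + 1 \<le> q" by simp
  then have "m + (m div 2 + 1) \<le> 3 * q" using m(1) by (auto elim!: evenE)
  also have "3 * q < 8 * q + 8" using q_ge_9 by simp
  also have "\<dots> = 8 * (q + 1)" by simp
  also have "\<dots> \<le> (q - 1) * (q + 1)" using q_ge_9 by (intro mult_le_mono1) simp
  finally show ?thesis by (simp only: degree_gen_poly code_length_eq)
qed

abbreviation ternary_code :: "'f vec set" where
  "ternary_code \<equiv> {c \<in> carrier_vec (3 ^ m - 1). gen_poly dvd word_poly c}"

lemma hamming_dist_ge_4:
  assumes "u \<in> ternary_code" and "v \<in> ternary_code" and "u \<noteq> v"
  shows "4 \<le> hamming_dist u v"
proof (rule ccontr)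
  assume d: "\<not> 4 \<le> hamming_dist u v"
  let ?n = "3 ^ m - 1 :: nat"
  have dim: "u \<in> carrier_vec ?n" "v \<in> carrier_vec ?n" using assms by auto
  define S where "S = {i. i < ?n \<and> u $ i \<noteq> v $ i}"
  define f where "f = (\<lambda>i. \<iota> (u $ i - v $ i))"
  have sums: "(\<Sum>i\<in>S. f i * \<beta> ^ i) = 0"
    if "eval_at \<beta> (word_poly u) = 0" "eval_at \<beta> (word_poly v) = 0" for \<beta>
  proof -
    have "(\<Sum>i\<in>S. f i * \<beta> ^ i) = (\<Sum>i<?n. f i * \<beta> ^ i)"
      by (rule sum.mono_neutral_left) (auto simp: S_def f_def)
    also have "\<dots> = eval_at \<beta> (word_poly u) - eval_at \<beta> (word_poly v)"
      unfolding eval_word_poly[OF dim(1)] eval_word_poly[OF dim(2)]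
      by (simp only: f_def hom_minus left_diff_distrib sum_subtractf)
    finally show ?thesis using that by simp
  qed
  have "S \<noteq> {}"
  proof
    assume "S = {}"
    then have "u = v" using dim by (intro eq_vecI) (auto simp: S_def)
    then show False using assms(3) by simp
  qed
  moreover have "finite S" by (simp add: S_def)
  moreover have "card S \<le> 3" using d dim by (simp add: hamming_dist_def S_def)
  moreover have "(f i)\<^sup>2 = 1" if "i \<in> S" for i
    unfolding f_def using that by (intro iota_square) (simp add: S_def)
  moreover have "\<alpha> ^ i \<noteq> 0" for i using alpha_nonzero by simp
  \<comment> \<open>Swapping exponents turns evaluation at a power of \<open>\<alpha>\<close> into a
    power sum of the locators \<open>\<alpha> ^ i\<close>.\<close>
  moreover have pow: "(\<alpha> ^ i) ^ j = (\<alpha> ^ j) ^ i" for i j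
    by (simp only: power_mult[symmetric] mult.commute)
  have "((\<alpha> ^ i) ^ s)\<^sup>2 = 1" for i
    unfolding pow[of i s] power_alpha_s by (simp add: power_mult[symmetric] mult.commute[of i 2])
  moreover have "inj_on (\<lambda>i. \<alpha> ^ i) S"
    by (rule inj_on_subset[OF inj_on_power_alpha]) (auto simp: S_def card_ext)
  moreover have "(\<Sum>i\<in>S. f i * \<alpha> ^ i) = 0" "(\<Sum>i\<in>S. f i * (\<alpha> ^ i) ^ (q + 1)) = 0"
    "(\<Sum>i\<in>S. f i * (\<alpha> ^ i) ^ s) = 0"
    unfolding pow[of _ "q + 1"] pow[of _ s] power_alpha_s
    using assms(1,2) by (intro sums; simp only: mem_Collect_eq gen_poly_dvd_iff)+
  ultimately show False
    using no_light_word[OF q t s three_eq_0, of S f "\<lambda>i. \<alpha> ^ i"] by blast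
qed

text \<open>Any code of this length and dimension is covered, so the bound serves both the distance
  of the code itself and its optimality.\<close>

lemma min_distance_le_4:
  fixes C :: "'f vec set"
  assumes "linear_code (3 ^ m - 1) (3 ^ m - 1 - degree gen_poly) d C"
  shows "d \<le> 4"
proof (rule ccontr)
  let ?n = "3 ^ m - 1 :: nat"
  assume "\<not> d \<le> 4"
  then have "4 < min_distance C" using assms by (simp add: linear_code_def)
  moreover have sub: "VectorSpace.subspace class_ring C (module_vec TYPE('f) ?n)"
    using assms by (simp add: linear_code_def)
  then have "C \<subseteq> carrier_vec ?n" by (auto simp: VectorSpace.subspace_def submodule_def module_vec_simps)
  ultimately have "card C * (s * (CARD('f) - 1))\<^sup>2 \<le> CARD('f) ^ ?n"
    using code_length_eq_2s by (intro double_error_packing) simp_all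
  moreover have "card C = 3 ^ (?n - degree gen_poly)"
    using card_subspace[OF sub] assms by (simp add: linear_code_def card_base)
  moreover have "s * (CARD('f) - 1) = ?n" unfolding code_length_eq_2s by (simp add: card_base)
  moreover have "(3 :: nat) ^ ?n = 3 ^ (?n - degree gen_poly) * 3 ^ degree gen_poly"
    using degree_gen_poly_less by (simp only: power_add[symmetric]) simp
  ultimately have "?n\<^sup>2 \<le> 3 ^ degree gen_poly"
    by (simp only: card_base mult_le_cancel1) simp
  moreover have "m + (m div 2 + 1) = m div 2 + m div 2 + m div 2 + 1" using m(1) by presburger
  then have "(3 :: nat) ^ degree gen_poly = q * q * q * 3"
    unfolding degree_gen_poly by (simp only: q power_add power_one_right)
  ultimately have le: "((q - 1) * (q + 1))\<^sup>2 \<le> q * q * q * 3" by (simp only: code_length_eq)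
  have "8 * q \<le> (q - 1) * (q + 1)"
    using q_ge_9 by (intro mult_le_mono) simp_all
  then have "(8 * q)\<^sup>2 \<le> ((q - 1) * (q + 1))\<^sup>2" by (rule power_mono) simp
  \<comment> \<open>After the shift by 9 both sides are polynomials in \<open>r\<close>, and each
    coefficient of the square exceeds its counterpart, so the comparison is linear in the
    monomials.\<close>
  moreover obtain r where r: "q = r + 9" using q_ge_9 by (metis le_Suc_ex add.commute)
  ultimately show False using le unfolding r by (simp add: power2_eq_square algebra_simps)
qed

lemma optimal_ternary_code: "optimal_code (3 ^ m - 1) (3 ^ m - 1 - degree gen_poly) 4 ternary_code"
proof -
  let ?n = "3 ^ m - 1 :: nat"
  have nz: "gen_poly \<noteq> 0" using lead_coeff_gen_poly by auto
  have lin: "linear_code ?n (?n - degree gen_poly) (min_distance ternary_code) ternary_code"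
    using degree_gen_poly_less by (intro linear_code_words_dvd nz) simp
  have "card ternary_code = 3 ^ (?n - degree gen_poly)"
    using card_words_dvd[OF nz, of ?n] degree_gen_poly_less by (simp add: card_base)
  moreover have "(3 :: nat) ^ 1 \<le> 3 ^ (?n - degree gen_poly)"
    using degree_gen_poly_less by (intro power_increasing) simp_all
  ultimately have "2 \<le> card ternary_code" by simp
  then obtain u v where "u \<in> ternary_code" "v \<in> ternary_code" "u \<noteq> v"
    by (auto simp: card_le_Suc_iff numeral_2_eq_2)
  \<comment> \<open>An infimum of a nonempty set of naturals is attained.\<close>
  then have "min_distance ternary_code \<in> {hamming_dist u v | u v. u \<in> ternary_code \<and> v \<in> ternary_code \<and> u \<noteq> v}"
    unfolding min_distance_def by (intro Inf_nat_def1) blast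
  then have "4 \<le> min_distance ternary_code" using hamming_dist_ge_4 by auto
  with min_distance_le_4[OF lin] have "min_distance ternary_code = 4" by simp
  with lin show ?thesis
    using min_distance_le_4 by (fastforce simp: optimal_code_def)
qed

end

section \<open>Transfer to integer exponents and conclusion\<close>

theorem corollary2:
  fixes \<iota> :: "'f::{field,finite} \<Rightarrow> 'a::{field,finite}"
    and \<alpha> :: 'a and m :: nat and e s :: int
  assumes "CARD('f) = 3" and "CARD('a) = 3 ^ m" and "field_hom \<iota>"
    and "mult_generator \<alpha>"
    and "m > 0" and "m mod 4 = 0"
    and "e = 3 ^ (m div 2) + 1" and "s = (3 ^ m - 1) div 2"
  shows "cyclic_code (3 ^ m - 1) (root_code \<iota> \<alpha> [1, e, s]) \<and>
    generator_poly (3 ^ m - 1) (root_code \<iota> \<alpha> [1, e, s]) (root_gen_poly \<iota> \<alpha> [1, e, s]) \<and>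
    optimal_code (3 ^ m - 1) (3 ^ m - (3 * m) div 2 - 2) 4 (root_code \<iota> \<alpha> [1, e, s])"
proof -
  define q :: nat where "q = 3 ^ (m div 2)"
  define t where "t = (q + 1) div 2"
  define s' where "s' = (q - 1) * t"
  obtain k where k: "m = 4 * k" "k > 0" using assms(5,6) by (auto dest!: mod_eq_0_iff_dvd[THEN iffD1] elim!: dvdE)
  \<comment> \<open>Divisibility of \<open>m\<close> by 4 makes q a power of 9, hence 1 modulo 4, so
    t is odd.\<close>
  have "q = 9 ^ k" by (simp add: q_def k power_mult)
  then have "q mod 4 = 1" using power_mod[of "9 :: nat" 4 k] by simp
  then have t: "q + 1 = 2 * t" "odd t" unfolding t_def by presburger+
  interpret field_hom \<iota> by fact
  interpret ternary_code_field \<iota> \<alpha> m q s' t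
    by unfold_locales (use assms t k in \<open>auto simp: q_def s'_def\<close>)
  have e: "e = int (q + 1)" using assms(7) by (simp add: q_def)
  have "int (3 ^ m - 1) = 3 ^ m - 1" by (simp add: of_nat_diff)
  then have s: "s = int s'" unfolding assms(8) code_length_eq_2s by simp
  have gen: "root_gen_poly \<iota> \<alpha> [1, e, s] = gen_poly"
  proof -
    have "\<alpha> powi e = \<alpha> ^ (q + 1)" unfolding e by (rule power_int_of_nat)
    moreover have "\<alpha> powi s = - 1" unfolding s power_int_of_nat by (rule power_alpha_s)
    ultimately show ?thesis by (simp add: root_gen_poly_def gen_poly_def)
  qed
  have code: "root_code \<iota> \<alpha> [1, e, s] = ternary_code"
    unfolding root_code_def gen card_ext by (rule code_generated_by_eq[OF gen_poly_dvd_modulus])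
  have n: "0 < (3 :: nat) ^ m - 1" using degree_gen_poly_less by linarith
  have "3 ^ m - (3 * m) div 2 - 2 = 3 ^ m - 1 - degree gen_poly"
    by (simp add: degree_gen_poly k)
  then show ?thesis
    using optimal_ternary_code cyclic_code_generated_by[OF n, of gen_poly]
      generator_poly_generated_by[OF n gen_poly_dvd_modulus lead_coeff_gen_poly]
    unfolding code gen code_generated_by_eq[OF gen_poly_dvd_modulus] by simp
qed

end
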